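(* Let $d<\infty$. Let $V=V_1\cup\dots\cup V_k$ and $W=W_1\cup\dots\cup W_k$ be two varieties in $\mathbb{B}_d$ such that $V_1,\dots,V_k$ are strongly disjoint varieties and $W_1,\dots,W_k$ are strongly disjoint varieties. If $\mathcal{M}_{V_i}$ is isomorphic to $\mathcal{M}_{W_i}$ (as algebras) for all $i=1,\dots,k$, then $\mathcal{M}_V$ is isomorphic to $\mathcal{M}_W$.
   Context: $\mathbb{B}_d$ is the open unit ball of $\mathbb{C}^d$. $H^2_d$ is the reproducing kernel Hilbert space on $\mathbb{B}_d$ with kernel $k_d(z,w)=\frac{1}{1-\langle z,w\rangle}$, and $\mathcal{M}_d=\operatorname{Mult}(H^2_d)$ is its multiplier algebra. A variety in $\mathbb{B}_d$ is a set of the form $\{z\in\mathbb{B}_d: f(z)=0\ \forall f\in E\}$ for some $E\subseteq H^2_d$. For a variety $V$, $\mathcal{M}_V=\{f|_V: f\in\mathcal{M}_d\}$. Varieties $V_1,\dots,V_k$ in $\mathbb{B}_d$ are called strongly disjoint if for every $i=1,\dots,k$ there exists $\phi_i\in\mathcal{M}_d$ such that $\phi_i\equiv1$ on $V_i$ and $\phi_i\equiv0$ on $V_j$ for all $j\ne i$. *)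

theory Defs
  imports "HOL-Analysis.Analysis"
begin

text \<open>
  A complex function on a set \<open>X\<close> is represented by a total function that vanishes outside \<open>X\<close>;
  this makes the representative unique and is compatible with the pointwise operations.
\<close>

definition restrict0 :: "'a set \<Rightarrow> ('a \<Rightarrow> complex) \<Rightarrow> 'a \<Rightarrow> complex" where
  "restrict0 X f = (\<lambda>x. if x \<in> X then f x else 0)"

definition functions_on :: "'a set \<Rightarrow> ('a \<Rightarrow> complex) set" where
  "functions_on X = {f. \<forall>x. x \<notin> X \<longrightarrow> f x = 0}"

definition function_subspace :: "'a set \<Rightarrow> ('a \<Rightarrow> complex) set \<Rightarrow> bool" where
  "function_subspace X H \<longleftrightarrow>
     H \<subseteq> functions_on X \<and> (\<lambda>x. 0) \<in> H \<and>
     (\<forall>f\<in>H. \<forall>g\<in>H. (\<lambda>x. f x + g x) \<in> H) \<and>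
     (\<forall>c. \<forall>f\<in>H. (\<lambda>x. c * f x) \<in> H)"

text \<open>Inner products are linear in the first and conjugate-linear in the second argument.\<close>

definition inner_product_on ::
  "('a \<Rightarrow> complex) set \<Rightarrow> (('a \<Rightarrow> complex) \<Rightarrow> ('a \<Rightarrow> complex) \<Rightarrow> complex) \<Rightarrow> bool" where
  "inner_product_on H ip \<longleftrightarrow>
     (\<forall>f\<in>H. \<forall>g\<in>H. \<forall>h\<in>H. ip (\<lambda>x. f x + g x) h = ip f h + ip g h) \<and>
     (\<forall>c. \<forall>f\<in>H. \<forall>h\<in>H. ip (\<lambda>x. c * f x) h = c * ip f h) \<and>
     (\<forall>f\<in>H. \<forall>g\<in>H. ip g f = cnj (ip f g)) \<and>
     (\<forall>f\<in>H. f \<noteq> (\<lambda>x. 0) \<longrightarrow> Re (ip f f) > 0)"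

definition ip_dist ::
  "(('a \<Rightarrow> complex) \<Rightarrow> ('a \<Rightarrow> complex) \<Rightarrow> complex) \<Rightarrow> ('a \<Rightarrow> complex) \<Rightarrow> ('a \<Rightarrow> complex) \<Rightarrow> real" where
  "ip_dist ip f g = sqrt (Re (ip (\<lambda>x. f x - g x) (\<lambda>x. f x - g x)))"

definition ip_complete ::
  "('a \<Rightarrow> complex) set \<Rightarrow> (('a \<Rightarrow> complex) \<Rightarrow> ('a \<Rightarrow> complex) \<Rightarrow> complex) \<Rightarrow> bool" where
  "ip_complete H ip \<longleftrightarrow>
     (\<forall>F :: nat \<Rightarrow> 'a \<Rightarrow> complex.
        (\<forall>n. F n \<in> H) \<and> (\<forall>e>0. \<exists>N. \<forall>m\<ge>N. \<forall>n\<ge>N. ip_dist ip (F m) (F n) < e)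
        \<longrightarrow> (\<exists>f\<in>H. (\<lambda>n. ip_dist ip (F n) f) \<longlonglongrightarrow> 0))"

text \<open>
  \<open>H\<close> with inner product \<open>ip\<close> is the reproducing kernel Hilbert space on \<open>X\<close> with kernel \<open>k\<close>.
  By the Moore-Aronszajn theorem such a pair exists for every positive semidefinite kernel, and
  \<open>H\<close> as well as the values of \<open>ip\<close> on \<open>H\<close> are uniquely determined by \<open>X\<close> and \<open>k\<close>.
\<close>

definition is_rkhs ::
  "'a set \<Rightarrow> ('a \<Rightarrow> 'a \<Rightarrow> complex) \<Rightarrow> ('a \<Rightarrow> complex) set \<Rightarrow>
   (('a \<Rightarrow> complex) \<Rightarrow> ('a \<Rightarrow> complex) \<Rightarrow> complex) \<Rightarrow> bool" where
  "is_rkhs X k H ip \<longleftrightarrow>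
     function_subspace X H \<and> inner_product_on H ip \<and> ip_complete H ip \<and>
     (\<forall>w\<in>X. restrict0 X (\<lambda>z. k z w) \<in> H \<and>
             (\<forall>f\<in>H. ip f (restrict0 X (\<lambda>z. k z w)) = f w))"

text \<open>
  The inner product of the library on \<^typ>\<open>complex ^ 'd\<close> is real-valued, hence a separate
  Hermitian inner product; the norms induced by both agree.
\<close>

definition herm :: "complex ^ 'd \<Rightarrow> complex ^ 'd \<Rightarrow> complex" where
  "herm z w = (\<Sum>i\<in>UNIV. z $ i * cnj (w $ i))"

abbreviation unit_ball :: "(complex ^ 'd) set" where
  "unit_ball \<equiv> ball 0 1"

definition is_drury_arveson ::
  "(complex ^ 'd \<Rightarrow> complex) set \<Rightarrow>
   ((complex ^ 'd \<Rightarrow> complex) \<Rightarrow> (complex ^ 'd \<Rightarrow> complex) \<Rightarrow> complex) \<Rightarrow> bool" where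
  "is_drury_arveson H ip \<longleftrightarrow> is_rkhs unit_ball (\<lambda>z w. 1 / (1 - herm z w)) H ip"

definition multipliers :: "'a set \<Rightarrow> ('a \<Rightarrow> complex) set \<Rightarrow> ('a \<Rightarrow> complex) set" where
  "multipliers X H = {\<phi> \<in> functions_on X. \<forall>f\<in>H. (\<lambda>x. \<phi> x * f x) \<in> H}"

definition is_variety :: "'a set \<Rightarrow> ('a \<Rightarrow> complex) set \<Rightarrow> 'a set \<Rightarrow> bool" where
  "is_variety X H V \<longleftrightarrow> (\<exists>E\<subseteq>H. V = {z \<in> X. \<forall>f\<in>E. f z = 0})"

definition restricted_multipliers ::
  "'a set \<Rightarrow> ('a \<Rightarrow> complex) set \<Rightarrow> 'a set \<Rightarrow> ('a \<Rightarrow> complex) set" where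
  "restricted_multipliers X H V = restrict0 V ` multipliers X H"

definition strongly_disjoint ::
  "'a set \<Rightarrow> ('a \<Rightarrow> complex) set \<Rightarrow> nat \<Rightarrow> (nat \<Rightarrow> 'a set) \<Rightarrow> bool" where
  "strongly_disjoint X H k V \<longleftrightarrow>
     (\<forall>i\<in>{1..k}. \<exists>\<phi>\<in>multipliers X H.
        (\<forall>z\<in>V i. \<phi> z = 1) \<and> (\<forall>j\<in>{1..k}. j \<noteq> i \<longrightarrow> (\<forall>z\<in>V j. \<phi> z = 0)))"

text \<open>Isomorphism of complex algebras of functions with the pointwise operations.\<close>

definition algebra_isomorphic :: "('a \<Rightarrow> complex) set \<Rightarrow> ('b \<Rightarrow> complex) set \<Rightarrow> bool" where
  "algebra_isomorphic A B \<longleftrightarrow>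
     (\<exists>T. bij_betw T A B \<and>
        (\<forall>f\<in>A. \<forall>g\<in>A. T (\<lambda>x. f x + g x) = (\<lambda>y. T f y + T g y)) \<and>
        (\<forall>c. \<forall>f\<in>A. T (\<lambda>x. c * f x) = (\<lambda>y. c * T f y)) \<and>
        (\<forall>f\<in>A. \<forall>g\<in>A. T (\<lambda>x. f x * g x) = (\<lambda>y. T f y * T g y)))"

end

(* A multiplier that is 1 on V_j and 0 on the other V_i acts on M_V as the idempotent cutting out
   the piece V_j. Hence restriction to the pieces identifies M_V with the direct product of the
   algebras M_{V_i}, and isomorphisms of the factors assemble to an isomorphism of the products. *)
theory Submission imports Defs begin

lemma multipliers_add:
  assumes "function_subspace X H" "\<phi> \<in> multipliers X H" "\<psi> \<in> multipliers X H"
  shows "(\<lambda>x. \<phi> x + \<psi> x) \<in> multipliers X H"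
  using assms by (auto simp: multipliers_def functions_on_def function_subspace_def distrib_right)

lemma multipliers_mult:
  assumes "\<phi> \<in> multipliers X H" "\<psi> \<in> multipliers X H"
  shows "(\<lambda>x. \<phi> x * \<psi> x) \<in> multipliers X H"
  using assms by (auto simp: multipliers_def functions_on_def mult.assoc)

text \<open>By induction on the index set. The empty sum is the zero function, which sends every
  element of \<open>H\<close> to the zero function, and this belongs to \<open>H\<close>.\<close>

lemma multipliers_sum:
  assumes "function_subspace X H" "finite I" "\<And>i. i \<in> I \<Longrightarrow> \<phi> i \<in> multipliers X H"
  shows "(\<lambda>x. \<Sum>i\<in>I. \<phi> i x) \<in> multipliers X H"
  using assms(2,3)
proof (induction I rule: finite_induct)
  case empty
  then show ?case
    using assms(1) by (auto simp: multipliers_def functions_on_def function_subspace_def)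
next
  case (insert i I)
  then show ?case
    using multipliers_add[OF assms(1), of "\<phi> i" "\<lambda>x. \<Sum>i\<in>I. \<phi> i x"] by simp
qed

text \<open>At a common point of two pieces the multiplier belonging to the first piece would have
  to be both 1 and 0.\<close>

lemma strongly_disjoint_disjoint:
  assumes "strongly_disjoint X H k V" "i \<in> {1..k}" "j \<in> {1..k}" "i \<noteq> j" "z \<in> V i"
  shows "z \<notin> V j"
  using assms unfolding strongly_disjoint_def by (metis zero_neq_one)

text \<open>A multiplier that induces \<open>f\<close> on \<open>V\<close> also induces the
  restriction of \<open>f\<close> on \<open>U\<close>.\<close>

lemma restrict0_restricted_multipliers:
  assumes "f \<in> restricted_multipliers X H V" "U \<subseteq> V"
  shows "restrict0 U f \<in> restricted_multipliers X H U"
proof -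
  obtain \<phi> where \<phi>: "\<phi> \<in> multipliers X H" "f = restrict0 V \<phi>"
    using assms(1) by (auto simp: restricted_multipliers_def)
  moreover have "restrict0 U (restrict0 V \<phi>) = restrict0 U \<phi>"
    using assms(2) by (auto simp: restrict0_def fun_eq_iff)
  ultimately show ?thesis
    by (auto simp: restricted_multipliers_def)
qed

lemma restricted_multipliers_outside:
  "f \<in> restricted_multipliers X H V \<Longrightarrow> z \<notin> V \<Longrightarrow> f z = 0"
  by (auto simp: restricted_multipliers_def restrict0_def)

text \<open>Functions on the pieces are extended by zero, so on disjoint pieces at most one summand
  is nonzero at each point, and the sum is the piecewise function with components
  \<open>g i\<close>. Written as a sum, it visibly respects addition and scalar
  multiplication.\<close>

definition glue :: "nat \<Rightarrow> (nat \<Rightarrow> 'a \<Rightarrow> complex) \<Rightarrow> 'a \<Rightarrow> complex" where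
  "glue k g = (\<lambda>x. \<Sum>i\<in>{1..k}. g i x)"

context
  fixes X :: "'a set" and H :: "('a \<Rightarrow> complex) set" and k :: nat and V :: "nat \<Rightarrow> 'a set"
  assumes sd: "strongly_disjoint X H k V"
begin

lemma glue_apply:
  assumes g: "\<And>i. i \<in> {1..k} \<Longrightarrow> g i \<in> restricted_multipliers X H (V i)"
    and j: "j \<in> {1..k}" and z: "z \<in> V j"
  shows "glue k g z = g j z"
proof -
  have "g i z = 0" if "i \<in> {1..k} - {j}" for i
    using that g j z strongly_disjoint_disjoint[OF sd j]
    by (intro restricted_multipliers_outside) auto
  then have "(\<Sum>i\<in>{1..k} - {j}. g i z) = 0"
    by (intro sum.neutral) blast
  then show ?thesis
    using sum.remove[OF finite_atLeastAtMost j, of "\<lambda>i. g i z"] by (simp add: glue_def)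
qed

lemma glue_outside:
  assumes "\<And>i. i \<in> {1..k} \<Longrightarrow> g i \<in> restricted_multipliers X H (V i)"
    and "z \<notin> (\<Union>i\<in>{1..k}. V i)"
  shows "glue k g z = 0"
  unfolding glue_def
  using assms by (intro sum.neutral ballI restricted_multipliers_outside) auto

text \<open>With \<open>glue_restrict0\<close> this shows that gluing and restricting to the pieces
  are inverse to each other. Both facts rest on the disjointness of the pieces.\<close>

lemma restrict0_glue:
  assumes "\<And>i. i \<in> {1..k} \<Longrightarrow> g i \<in> restricted_multipliers X H (V i)"
    and "j \<in> {1..k}"
  shows "restrict0 (V j) (glue k g) = g j"
  using glue_apply[OF assms] restricted_multipliers_outside[OF assms(1)[OF assms(2)]]
  by (auto simp: restrict0_def)

lemma glue_restrict0:
  assumes f: "f \<in> restricted_multipliers X H (\<Union>i\<in>{1..k}. V i)"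
  shows "glue k (\<lambda>i. restrict0 (V i) f) = f"
proof
  fix z
  have r: "restrict0 (V i) f \<in> restricted_multipliers X H (V i)" if "i \<in> {1..k}" for i
    using that by (intro restrict0_restricted_multipliers[OF f]) auto
  show "glue k (\<lambda>i. restrict0 (V i) f) z = f z"
  proof (cases "z \<in> (\<Union>i\<in>{1..k}. V i)")
    case True
    then obtain j where "j \<in> {1..k}" "z \<in> V j" by auto
    then show ?thesis
      using glue_apply[OF r] by (simp add: restrict0_def)
  next
    case False
    then show ?thesis
      using glue_outside[OF r] restricted_multipliers_outside[OF f] by simp
  qed
qed

text \<open>Here disjointness alone does not suffice: the glued function has to be induced by a
  single multiplier on all of \<open>X\<close>. The separating multipliers from strong disjointness
  serve to build it.\<close>

lemma glue_restricted_multipliers: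
  assumes H: "function_subspace X H"
    and g: "\<And>i. i \<in> {1..k} \<Longrightarrow> g i \<in> restricted_multipliers X H (V i)"
  shows "glue k g \<in> restricted_multipliers X H (\<Union>i\<in>{1..k}. V i)"
proof -
  have "\<exists>\<psi>. \<forall>i\<in>{1..k}. \<psi> i \<in> multipliers X H \<and> g i = restrict0 (V i) (\<psi> i)"
    using g unfolding restricted_multipliers_def by (intro bchoice) blast
  then obtain \<psi> where \<psi>: "\<And>i. i \<in> {1..k} \<Longrightarrow> \<psi> i \<in> multipliers X H"
      "\<And>i. i \<in> {1..k} \<Longrightarrow> g i = restrict0 (V i) (\<psi> i)"
    by blast
  have "\<exists>\<phi>. \<forall>i\<in>{1..k}. \<phi> i \<in> multipliers X H \<and>
      (\<forall>z\<in>V i. \<phi> i z = 1) \<and> (\<forall>j\<in>{1..k}. j \<noteq> i \<longrightarrow> (\<forall>z\<in>V j. \<phi> i z = 0))"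
    using sd unfolding strongly_disjoint_def by (intro bchoice) blast
  then obtain \<phi> where \<phi>: "\<And>i. i \<in> {1..k} \<Longrightarrow> \<phi> i \<in> multipliers X H"
      "\<And>i z. i \<in> {1..k} \<Longrightarrow> z \<in> V i \<Longrightarrow> \<phi> i z = 1"
      "\<And>i j z. i \<in> {1..k} \<Longrightarrow> j \<in> {1..k} \<Longrightarrow> j \<noteq> i \<Longrightarrow> z \<in> V j \<Longrightarrow> \<phi> i z = 0"
    by blast
  \<comment> \<open>Nothing is known about \<open>\<psi> i\<close> on the other pieces. The factor
    \<open>\<phi> i\<close> removes it there and leaves it unchanged on \<open>V i\<close>, so the
    sum equals \<open>\<psi> j\<close> on each \<open>V j\<close>.\<close>
  define \<theta> where "\<theta> = (\<lambda>z. \<Sum>i\<in>{1..k}. \<phi> i z * \<psi> i z)"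
  have "\<theta> \<in> multipliers X H"
    unfolding \<theta>_def by (intro multipliers_sum[OF H] multipliers_mult \<phi> \<psi>) auto
  moreover have "glue k g = restrict0 (\<Union>i\<in>{1..k}. V i) \<theta>"
  proof
    fix z
    show "glue k g z = restrict0 (\<Union>i\<in>{1..k}. V i) \<theta> z"
    proof (cases "z \<in> (\<Union>i\<in>{1..k}. V i)")
      case True
      then obtain j where j: "j \<in> {1..k}" "z \<in> V j" by auto
      have "(\<Sum>i\<in>{1..k} - {j}. \<phi> i z * \<psi> i z) = 0"
        using j by (intro sum.neutral ballI) (auto simp: \<phi>(3)[of _ j])
      then have "\<theta> z = \<psi> j z"
        using sum.remove[OF finite_atLeastAtMost j(1), of "\<lambda>i. \<phi> i z * \<psi> i z"] \<phi>(2)[OF j]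
        by (simp add: \<theta>_def)
      then show ?thesis
        using True glue_apply[OF g j] \<psi>(2)[OF j(1)] j by (simp add: restrict0_def)
    next
      case False
      then show ?thesis
        using glue_outside[OF g False] by (simp add: restrict0_def)
    qed
  qed
  ultimately show ?thesis
    by (auto simp: restricted_multipliers_def)
qed

end

lemma algebra_isomorphic_Union:
  assumes HX: "function_subspace X H" and HY: "function_subspace Y K"
    and V: "strongly_disjoint X H k V" and W: "strongly_disjoint Y K k W"
    and iso: "\<And>i. i \<in> {1..k} \<Longrightarrow>
      algebra_isomorphic (restricted_multipliers X H (V i)) (restricted_multipliers Y K (W i))"
  shows "algebra_isomorphic (restricted_multipliers X H (\<Union>i\<in>{1..k}. V i))
           (restricted_multipliers Y K (\<Union>i\<in>{1..k}. W i))"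
proof -
  let ?A = "\<lambda>i. restricted_multipliers X H (V i)" and ?B = "\<lambda>i. restricted_multipliers Y K (W i)"
  let ?AV = "restricted_multipliers X H (\<Union>i\<in>{1..k}. V i)"
  let ?BW = "restricted_multipliers Y K (\<Union>i\<in>{1..k}. W i)"
  have "\<exists>T. \<forall>i\<in>{1..k}. bij_betw (T i) (?A i) (?B i) \<and>
      (\<forall>f\<in>?A i. \<forall>g\<in>?A i. T i (\<lambda>x. f x + g x) = (\<lambda>y. T i f y + T i g y)) \<and>
      (\<forall>c. \<forall>f\<in>?A i. T i (\<lambda>x. c * f x) = (\<lambda>y. c * T i f y)) \<and>
      (\<forall>f\<in>?A i. \<forall>g\<in>?A i. T i (\<lambda>x. f x * g x) = (\<lambda>y. T i f y * T i g y))"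
    using iso unfolding algebra_isomorphic_def by (intro bchoice ballI)
  then obtain T where
      bij: "\<And>i. i \<in> {1..k} \<Longrightarrow> bij_betw (T i) (?A i) (?B i)"
      and add: "\<And>i f g. i \<in> {1..k} \<Longrightarrow> f \<in> ?A i \<Longrightarrow> g \<in> ?A i \<Longrightarrow>
        T i (\<lambda>x. f x + g x) = (\<lambda>y. T i f y + T i g y)"
      and scale: "\<And>i c f. i \<in> {1..k} \<Longrightarrow> f \<in> ?A i \<Longrightarrow> T i (\<lambda>x. c * f x) = (\<lambda>y. c * T i f y)"
      and mult: "\<And>i f g. i \<in> {1..k} \<Longrightarrow> f \<in> ?A i \<Longrightarrow> g \<in> ?A i \<Longrightarrow>
        T i (\<lambda>x. f x * g x) = (\<lambda>y. T i f y * T i g y)"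
    by blast
  \<comment> \<open>A mere set-theoretic inverse is enough: \<open>S\<close> only serves to prove
    bijectivity, since \<open>algebra_isomorphic\<close> asks for compatibility with the operations
    in one direction.\<close>
  define S where "S i = inv_into (?A i) (T i)" for i
  have ST: "S i (T i f) = f" if "i \<in> {1..k}" "f \<in> ?A i" for i f
    using bij[OF that(1)] that(2) by (simp add: S_def bij_betw_inv_into_left)
  have TS: "T i (S i g) = g" if "i \<in> {1..k}" "g \<in> ?B i" for i g
    using bij[OF that(1)] that(2) by (simp add: S_def bij_betw_inv_into_right)
  have TB: "T i f \<in> ?B i" if "i \<in> {1..k}" "f \<in> ?A i" for i f
    using bij[OF that(1)] that(2) by (rule bij_betwE[THEN bspec])
  have SA: "S i g \<in> ?A i" if "i \<in> {1..k}" "g \<in> ?B i" for i g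
    using bij_betw_inv_into[OF bij[OF that(1)]] that(2) unfolding S_def
    by (rule bij_betwE[THEN bspec])
  have rA: "restrict0 (V i) f \<in> ?A i" if "f \<in> ?AV" "i \<in> {1..k}" for f i
    using that by (intro restrict0_restricted_multipliers[OF that(1)]) auto
  have rB: "restrict0 (W i) g \<in> ?B i" if "g \<in> ?BW" "i \<in> {1..k}" for g i
    using that by (intro restrict0_restricted_multipliers[OF that(1)]) auto
  \<comment> \<open>\<open>F\<close> is the product of the maps \<open>T i\<close>, transported to
    the unions by restricting first and gluing afterwards. \<open>G\<close> is built from the
    inverses \<open>S i\<close> in the same way.\<close>
  define F where "F f = glue k (\<lambda>i. T i (restrict0 (V i) f))" for f
  define G where "G g = glue k (\<lambda>i. S i (restrict0 (W i) g))" for g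
  have FB: "F f \<in> ?BW" if "f \<in> ?AV" for f
    unfolding F_def by (intro glue_restricted_multipliers[OF W HY] TB rA that)
  have GA: "G g \<in> ?AV" if "g \<in> ?BW" for g
    unfolding G_def by (intro glue_restricted_multipliers[OF V HX] SA rB that)
  have GF: "G (F f) = f" if f: "f \<in> ?AV" for f
  proof -
    \<comment> \<open>Restricting to \<open>W i\<close> undoes the gluing in \<open>F\<close> and
      returns the component \<open>T i (restrict0 (V i) f)\<close>, which \<open>S i\<close> then
      inverts.\<close>
    have "S i (restrict0 (W i) (F f)) = restrict0 (V i) f" if i: "i \<in> {1..k}" for i
      unfolding F_def using restrict0_glue[OF W TB[OF _ rA[OF f]] i] ST[OF i rA[OF f i]] by simp
    then have "G (F f) = glue k (\<lambda>i. restrict0 (V i) f)"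
      by (simp add: G_def glue_def)
    then show ?thesis
      using glue_restrict0[OF V f] by simp
  qed
  have FG: "F (G g) = g" if g: "g \<in> ?BW" for g
  proof -
    have "T i (restrict0 (V i) (G g)) = restrict0 (W i) g" if i: "i \<in> {1..k}" for i
      unfolding G_def using restrict0_glue[OF V SA[OF _ rB[OF g]] i] TS[OF i rB[OF g i]] by simp
    then have "F (G g) = glue k (\<lambda>i. restrict0 (W i) g)"
      by (simp add: F_def glue_def)
    then show ?thesis
      using glue_restrict0[OF W g] by simp
  qed
  have "bij_betw F ?AV ?BW"
    using GF FG FB GA by (intro bij_betw_byWitness[where f' = G]) auto
  moreover have "F (\<lambda>x. f x + g x) = (\<lambda>y. F f y + F g y)" if f: "f \<in> ?AV" and g: "g \<in> ?AV" for f g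
  proof -
    \<comment> \<open>Cutting off to \<open>V i\<close> is pointwise and commutes with addition, so
      additivity of \<open>T i\<close> applies to the two restrictions, which lie in its
      domain.\<close>
    have r: "restrict0 (V i) (\<lambda>x. f x + g x) = (\<lambda>x. restrict0 (V i) f x + restrict0 (V i) g x)" for i
      by (auto simp: restrict0_def)
    have "F (\<lambda>x. f x + g x) =
        (\<lambda>y. \<Sum>i\<in>{1..k}. T i (restrict0 (V i) f) y + T i (restrict0 (V i) g) y)"
      unfolding F_def glue_def r by (intro ext sum.cong refl) (simp only: add rA f g)
    then show ?thesis
      by (simp add: F_def glue_def sum.distrib)
  qed
  moreover have "F (\<lambda>x. c * f x) = (\<lambda>y. c * F f y)" if f: "f \<in> ?AV" for c f
  proof -
    have r: "restrict0 (V i) (\<lambda>x. c * f x) = (\<lambda>x. c * restrict0 (V i) f x)" for i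
      by (auto simp: restrict0_def)
    have "F (\<lambda>x. c * f x) = (\<lambda>y. \<Sum>i\<in>{1..k}. c * T i (restrict0 (V i) f) y)"
      unfolding F_def glue_def r by (intro ext sum.cong refl) (simp only: scale rA f)
    then show ?thesis
      by (simp add: F_def glue_def sum_distrib_left)
  qed
  moreover have "F (\<lambda>x. f x * g x) = (\<lambda>y. F f y * F g y)" if f: "f \<in> ?AV" and g: "g \<in> ?AV" for f g
  proof
    fix y
    have r: "restrict0 (V i) (\<lambda>x. f x * g x) = (\<lambda>x. restrict0 (V i) f x * restrict0 (V i) g x)" for i
      by (auto simp: restrict0_def)
    have F_mult: "F (\<lambda>x. f x * g x) y =
        (\<Sum>i\<in>{1..k}. T i (restrict0 (V i) f) y * T i (restrict0 (V i) g) y)"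
      unfolding F_def glue_def r by (intro sum.cong refl) (simp only: mult rA f g)
    \<comment> \<open>The left side is a single sum over the pieces, whereas the right side is a
      product of two sums with cross terms. At a point of \<open>W j\<close> all components with
      index other than \<open>j\<close> vanish, so each sum reduces to its term at
      \<open>j\<close>.\<close>
    show "F (\<lambda>x. f x * g x) y = F f y * F g y"
    proof (cases "y \<in> (\<Union>i\<in>{1..k}. W i)")
      case True
      then obtain j where j: "j \<in> {1..k}" "y \<in> W j" by auto
      have "T i (restrict0 (V i) f) y = 0" if "i \<in> {1..k} - {j}" for i
        using that j strongly_disjoint_disjoint[OF W j(1)]
        by (intro restricted_multipliers_outside[OF TB[OF _ rA[OF f]]]) auto
      then have "(\<Sum>i\<in>{1..k} - {j}. T i (restrict0 (V i) f) y * T i (restrict0 (V i) g) y) = 0"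
        by (intro sum.neutral ballI) simp
      then have "F (\<lambda>x. f x * g x) y = T j (restrict0 (V j) f) y * T j (restrict0 (V j) g) y"
        unfolding F_mult sum.remove[OF finite_atLeastAtMost j(1)] by simp
      then show ?thesis
        unfolding F_def
        using glue_apply[OF W TB[OF _ rA[OF f]] j] glue_apply[OF W TB[OF _ rA[OF g]] j] by simp
    next
      case False
      \<comment> \<open>Off the union one vanishing factor settles both sides: each summand on the
        left contains a component of \<open>F f\<close>, and on the right \<open>F f y\<close>
        itself is 0.\<close>
      then have "T i (restrict0 (V i) f) y = 0" if "i \<in> {1..k}" for i
        using that by (intro restricted_multipliers_outside[OF TB[OF _ rA[OF f]]]) auto
      then show ?thesis
        using restricted_multipliers_outside[OF FB[OF f] False] by (simp add: F_mult)
    qed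
  qed
  ultimately show ?thesis
    unfolding algebra_isomorphic_def by blast
qed

theorem theorem6p5:
  fixes H :: "(complex ^ 'd \<Rightarrow> complex) set"
    and ip :: "(complex ^ 'd \<Rightarrow> complex) \<Rightarrow> (complex ^ 'd \<Rightarrow> complex) \<Rightarrow> complex"
    and k :: nat
    and V W :: "(complex ^ 'd) set"
    and Vs Ws :: "nat \<Rightarrow> (complex ^ 'd) set"
  assumes "is_drury_arveson H ip"
    and "is_variety unit_ball H V" and "V = (\<Union>i\<in>{1..k}. Vs i)"
    and "is_variety unit_ball H W" and "W = (\<Union>i\<in>{1..k}. Ws i)"
    and "\<And>i. i \<in> {1..k} \<Longrightarrow> is_variety unit_ball H (Vs i)"
    and "strongly_disjoint unit_ball H k Vs"
    and "\<And>i. i \<in> {1..k} \<Longrightarrow> is_variety unit_ball H (Ws i)"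
    and "strongly_disjoint unit_ball H k Ws"
    and "\<And>i. i \<in> {1..k} \<Longrightarrow>
           algebra_isomorphic (restricted_multipliers unit_ball H (Vs i))
                              (restricted_multipliers unit_ball H (Ws i))"
  shows "algebra_isomorphic (restricted_multipliers unit_ball H V)
                            (restricted_multipliers unit_ball H W)"
proof -
  have "function_subspace unit_ball H"
    using assms(1) by (simp add: is_drury_arveson_def is_rkhs_def)
  \<comment> \<open>Both unions lie in the same ball and use the same space, so the one fact about
    \<open>H\<close> fills both subspace hypotheses.\<close>
  from algebra_isomorphic_Union[OF this this assms(7,9,10)] show ?thesis
    unfolding assms(3,5) .
qed

end
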